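(* Let $V$ be an $n$-dimensional vector space over $\mathbb{R}$, regarded as a topological group under addition with its usual (Euclidean) topology. Then $V$ admits a continuous inverse ambiguous function if and only if $n$ is even.
   Context: For a group $G$, a function $f : G \to G$ is called inverse ambiguous if it is bijective and its inverse function satisfies $f^{-1}(x) = (f(x))^{-1}$ for all $x \in G$, where the right-hand side is the group inverse of $f(x)$. Equivalently, $f(f(x)) = x^{-1}$ for all $x \in G$; for the additive group of $V$ this reads $f(f(v)) = -v$ for all $v \in V$. The function $f$ is not required to be linear. *)

theory Defs
  imports "HOL-Analysis.Analysis"
begin

definition inverse_ambiguous :: "('g::group_add \<Rightarrow> 'g) \<Rightarrow> bool" where
  "inverse_ambiguous f \<longleftrightarrow> bij f \<and> (\<forall>x. inv f x = - f x)"

text \<open>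
  The class \<^class>\<open>real_vector\<close> carries no topology. The usual topology of a
  finite-dimensional space is the one transported from \<open>\<real>\<^sup>n\<close> along the linear
  isomorphism given by a basis \<open>b 0, \<dots>, b (n - 1)\<close>; it does not depend on the basis.
  \<^term>\<open>Euclidean_space n\<close> is \<open>\<real>\<^sup>n\<close>, realised as the functions \<open>nat \<Rightarrow> real\<close> that vanish
  at all indices \<open>i \<ge> n\<close>; the case \<open>n = 0\<close> is a single point.
\<close>

definition usual_topology :: "'v::real_vector topology \<Rightarrow> bool" where
  "usual_topology T \<longleftrightarrow>
     (\<exists>n. \<exists>b :: nat \<Rightarrow> 'v.
        inj_on b {..<n} \<and> independent (b ` {..<n}) \<and> span (b ` {..<n}) = UNIV \<and>
        homeomorphic_map (Euclidean_space n) T (\<lambda>x. \<Sum>i<n. x i *\<^sub>R b i))"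

end

theory Submission
  imports Defs "HOL-Homology.Brouwer_Degree"
begin

text \<open>
  An inverse ambiguous map is a square root of \<open>-id\<close> under composition. If \<open>n\<close> is even, rotating
  each pair of coordinates by a right angle is such a root. Conversely, a continuous root \<open>f\<close> on
  \<open>\<real>\<^sup>n\<close> vanishes exactly at the origin, so \<open>g = f / |f|\<close> is a self-map of the unit sphere, and
  \<open>g \<circ> g\<close> is homotopic to the antipodal map. Hence \<open>(deg g)\<^sup>2 = (- 1) ^ n\<close> and \<open>n\<close> is even.
\<close>

section \<open>The degree of the antipodal map\<close>

lemma continuous_map_nsphere_transpose:
  assumes "k \<le> p"
  shows "continuous_map (nsphere p) (nsphere p) (\<lambda>x i. x (Transposition.transpose 0 k i))"
proof -
  have perm: "bij_betw (Transposition.transpose 0 k) {..p} {..p}"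
    by (rule bij_betw_byWitness[where f' = "Transposition.transpose 0 k"]) (use assms in \<open>auto simp: Transposition.transpose_def\<close>)
  have "(\<Sum>i\<le>p. (x (Transposition.transpose 0 k i))\<^sup>2) = (\<Sum>i\<le>p. (x i)\<^sup>2)" for x :: "nat \<Rightarrow> real"
    by (rule sum.reindex_bij_betw[OF perm])
  moreover have "Transposition.transpose 0 k i = i" if "i > p" for i
    using that assms by (auto simp: Transposition.transpose_def)
  ultimately show ?thesis
    unfolding nsphere
    by (auto simp: continuous_map_in_subtopology continuous_map_componentwise_UNIV
        intro!: continuous_map_from_subtopology continuous_map_product_projection)
qed

text \<open>Conjugating by the swap \<open>s\<close> of coordinates 0 and \<open>k\<close> carries
  the reflection in coordinate 0, of degree -1, to the one in coordinate \<open>k\<close>. As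
  \<open>s\<close> is an involution, its degree squares to 1 and cancels, so its sign need not be
  computed.\<close>

lemma Brouwer_degree2_reflection_coordinate:
  assumes "k \<le> p"
  shows "Brouwer_degree2 p (\<lambda>x i. if i = k then - x i else x i) = - 1"
proof -
  define s :: "(nat \<Rightarrow> real) \<Rightarrow> nat \<Rightarrow> real" where "s = (\<lambda>x i. x (Transposition.transpose 0 k i))"
  define r :: "nat \<Rightarrow> (nat \<Rightarrow> real) \<Rightarrow> nat \<Rightarrow> real"
    where "r = (\<lambda>k x i. if i = k then - x i else x i)"
  have s: "continuous_map (nsphere p) (nsphere p) s"
    unfolding s_def by (rule continuous_map_nsphere_transpose[OF assms])
  have r: "continuous_map (nsphere p) (nsphere p) (r j)" for j
    unfolding r_def by (rule continuous_map_nsphere_reflection)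
  have "s \<circ> s = id"
    by (auto simp: s_def fun_eq_iff)
  then have s2: "Brouwer_degree2 p s * Brouwer_degree2 p s = 1"
    using Brouwer_degree2_compose[OF s s] by simp
  have "r k = s \<circ> (r 0 \<circ> s)"
    by (auto simp: s_def r_def fun_eq_iff Transposition.transpose_def)
  then have "Brouwer_degree2 p (r k)
      = Brouwer_degree2 p s * (Brouwer_degree2 p (r 0) * Brouwer_degree2 p s)"
    using r s by (simp add: Brouwer_degree2_compose continuous_map_compose)
  also have "Brouwer_degree2 p (r 0) = - 1"
    unfolding r_def by (rule Brouwer_degree2_reflection)
  finally show ?thesis
    using s2 by (simp add: r_def)
qed

text \<open>Coordinates are negated one at a time, each reflection contributing a factor -1.
  Continuity is carried through the induction because multiplicativity of the degree requires
  it.\<close>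

lemma Brouwer_degree2_negate_coordinates:
  assumes "m \<le> Suc p"
  shows "continuous_map (nsphere p) (nsphere p) (\<lambda>x i. if i < m then - x i else x i) \<and>
         Brouwer_degree2 p (\<lambda>x i. if i < m then - x i else x i) = (- 1) ^ m"
  using assms
proof (induction m)
  case 0
  show ?case
    using Brouwer_degree2_id[of p] by (simp add: id_def)
next
  case (Suc m)
  have "(\<lambda>(x :: nat \<Rightarrow> real) i. if i < Suc m then - x i else x i)
      = (\<lambda>x i. if i = m then - x i else x i) \<circ> (\<lambda>x i. if i < m then - x i else x i)"
    by (auto simp: fun_eq_iff less_Suc_eq)
  then show ?case
    using Suc Brouwer_degree2_reflection_coordinate[of m p]
    by (simp add: Brouwer_degree2_compose
        continuous_map_compose[OF _ continuous_map_nsphere_reflection]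
        continuous_map_nsphere_reflection)
qed

lemma Brouwer_degree2_antipodal:
  "Brouwer_degree2 p (\<lambda>x i. - x i) = (- 1) ^ Suc p"
proof -
  \<comment> \<open>The two maps agree on the sphere, whose points vanish beyond index
    \<open>p\<close>; the degree depends only on the values there.\<close>
  have "Brouwer_degree2 p (\<lambda>x i. - x i) = Brouwer_degree2 p (\<lambda>x i. if i < Suc p then - x i else x i)"
    by (rule Brouwer_degree2_eq) (auto simp: nsphere fun_eq_iff)
  then show ?thesis
    using Brouwer_degree2_negate_coordinates[of "Suc p" p] by simp
qed

section \<open>Square roots of the antipodal map of \<open>\<real>\<^sup>n\<close>\<close>

text \<open>This and the next lemma present both spaces as subspaces of the type
  \<open>nat \<Rightarrow> real\<close>, so that continuity can be handled with
  \<open>continuous_on\<close>.\<close>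

lemma Euclidean_space_eq_top_of_set: "Euclidean_space n = top_of_set {x. \<forall>i\<ge>n. x i = 0}"
  by (simp add: Euclidean_space_def euclidean_product_topology)

lemma nsphere_eq_top_of_set:
  "nsphere p = top_of_set {x. (\<Sum>i\<le>p. (x i)\<^sup>2) = 1 \<and> (\<forall>i>p. x i = 0)}"
  by (simp add: nsphere euclidean_product_topology)

text \<open>Radial projection to the unit sphere. The finite sum is the full squared Euclidean norm
  only for vectors supported on the indices up to \<open>p\<close>.\<close>

definition normalize_upto :: "nat \<Rightarrow> (nat \<Rightarrow> real) \<Rightarrow> nat \<Rightarrow> real" where
  "normalize_upto p x = (\<lambda>i. x i / sqrt (\<Sum>j\<le>p. (x j)\<^sup>2))"

lemma sum_squares_upto_pos:
  fixes x :: "nat \<Rightarrow> real"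
  assumes "\<forall>i\<ge>Suc p. x i = 0" "x \<noteq> (\<lambda>i. 0)"
  shows "0 < (\<Sum>j\<le>p. (x j)\<^sup>2)"
proof -
  obtain i where i: "x i \<noteq> 0"
    using assms(2) by auto
  then have "i \<le> p"
    using assms(1) not_less_eq_eq by blast
  then show ?thesis
    using i by (intro sum_pos2[of _ i]) auto
qed

lemma normalize_upto_in_sphere:
  assumes "\<forall>i\<ge>Suc p. x i = 0" "x \<noteq> (\<lambda>i. 0)"
  shows "(\<Sum>i\<le>p. (normalize_upto p x i)\<^sup>2) = 1 \<and> (\<forall>i>p. normalize_upto p x i = 0)"
  using sum_squares_upto_pos[OF assms] assms(1)
  by (auto simp: normalize_upto_def power_divide simp flip: sum_divide_distrib)

lemma continuous_on_normalize_upto: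
  "continuous_on {x. (\<forall>i\<ge>Suc p. x i = 0) \<and> x \<noteq> (\<lambda>i. 0)} (normalize_upto p)"
  unfolding normalize_upto_def
proof (rule continuous_on_coordinatewise_then_product)
  fix i
  have coord: "continuous_on A (\<lambda>x :: nat \<Rightarrow> real. x j)" for A j
    by (rule continuous_on_subset[OF continuous_on_product_coordinates]) auto
  show "continuous_on {x. (\<forall>i\<ge>Suc p. x i = 0) \<and> x \<noteq> (\<lambda>i. 0)}
          (\<lambda>x. x i / sqrt (\<Sum>j\<le>p. (x j)\<^sup>2))"
  proof (intro continuous_intros coord ballI)
    fix x :: "nat \<Rightarrow> real"
    assume "x \<in> {x. (\<forall>i\<ge>Suc p. x i = 0) \<and> x \<noteq> (\<lambda>i. 0)}"
    then show "sqrt (\<Sum>j\<le>p. (x j)\<^sup>2) \<noteq> 0"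
      using sum_squares_upto_pos[of p x] by simp
  qed
qed

lemma even_if_square_root_of_antipodal:
  assumes cont: "continuous_map (Euclidean_space n) (Euclidean_space n) f"
    and ff: "\<And>x. x \<in> topspace (Euclidean_space n) \<Longrightarrow> f (f x) = (\<lambda>i. - x i)"
  shows "even n"
proof (cases n)
  \<comment> \<open>The unit sphere of the space has dimension \<open>p\<close>, one less than
    \<open>n\<close>. The remaining case of dimension 0 has no sphere and is trivially even.\<close>
  case (Suc p)
  define E where "E = {x :: nat \<Rightarrow> real. \<forall>i\<ge>Suc p. x i = 0}"
  define S where "S = {x :: nat \<Rightarrow> real. (\<Sum>i\<le>p. (x i)\<^sup>2) = 1 \<and> (\<forall>i>p. x i = 0)}"
  let ?o = "\<lambda>i::nat. 0::real"
  let ?N = "normalize_upto p"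
  have nsphere_S: "nsphere p = top_of_set S"
    by (simp add: nsphere_eq_top_of_set S_def)
  have "continuous_map (top_of_set E) (top_of_set E) f"
    using cont by (simp add: Suc Euclidean_space_eq_top_of_set E_def)
  then have contf: "continuous_on E f" and fE: "\<And>x. x \<in> E \<Longrightarrow> f x \<in> E"
    by auto
  have ffE: "f (f x) = (\<lambda>i. - x i)" if "x \<in> E" for x
    using ff that by (simp add: Suc topspace_Euclidean_space E_def)
  have oE: "?o \<in> E"
    by (simp add: E_def)
  \<comment> \<open>Evaluating \<open>f (f (f ?o))\<close> in two ways gives \<open>f ?o\<close> and
    its negative, so \<open>f\<close> fixes the origin.\<close>
  have "f (f (f ?o)) = (\<lambda>i. - f ?o i)" "f (f ?o) = ?o"
    using ffE[OF oE] ffE[OF fE[OF oE]] by simp_all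
  then have fo: "f ?o = ?o"
    by (auto simp: fun_eq_iff)
  have fnz: "f x \<noteq> ?o" if "x \<in> E" "x \<noteq> ?o" for x
  proof
    assume "f x = ?o"
    then have "(\<lambda>i. - x i) = ?o"
      using ffE[OF that(1)] fo by simp
    then show False
      using that(2) by (simp add: fun_eq_iff)
  qed
  have SE: "x \<in> E \<and> x \<noteq> ?o" if "x \<in> S" for x
    using that by (auto simp: S_def E_def Suc_le_eq)
  have NS: "?N x \<in> S" if "x \<in> E" "x \<noteq> ?o" for x
    using normalize_upto_in_sphere[of p x] that by (simp add: S_def E_def)
  have contN: "continuous_on (E - {?o}) ?N"
    using continuous_on_normalize_upto[of p] by (simp add: E_def set_diff_eq)
  define g where "g = (\<lambda>x. ?N (f x))"
  have contg: "continuous_on (E - {?o}) g"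
    unfolding g_def
    by (rule continuous_on_compose2[OF contN continuous_on_subset[OF contf]]) (use fE fnz in auto)
  have gS: "g x \<in> S" if "x \<in> E" "x \<noteq> ?o" for x
    unfolding g_def using that by (intro NS fE fnz)
  have cmg: "continuous_map (nsphere p) (nsphere p) g"
    unfolding nsphere_S using SE gS by (auto intro: continuous_on_subset[OF contg])
  \<comment> \<open>For fixed \<open>x\<close> the segment from \<open>f x\<close> to
    \<open>g x\<close> lies on one open ray from the origin, so \<open>g\<close> can be applied
    along it. Then \<open>g \<circ> h\<close> starts at the normalization of \<open>f (f x)\<close>,
    which is the antipode of the unit vector \<open>x\<close>, and ends at
    \<open>g (g x)\<close>.\<close>
  define h where "h = (\<lambda>(t::real, x) i. (1 - t) * f x i + t * g x i)"
  have h_scale: "h (t, x) i = ((1 - t) + t / sqrt (\<Sum>j\<le>p. (f x j)\<^sup>2)) * f x i" for t x i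
    by (simp add: h_def g_def normalize_upto_def field_simps)
  have hE: "h (t, x) \<in> E \<and> h (t, x) \<noteq> ?o" if "t \<in> {0..1}" "x \<in> S" for t x
  proof -
    have fx: "f x \<in> E" "f x \<noteq> ?o"
      using fE fnz SE[OF that(2)] by auto
    then have "0 < sqrt (\<Sum>j\<le>p. (f x j)\<^sup>2)"
      using sum_squares_upto_pos[of p "f x"] by (simp add: E_def)
    then have "0 < (1 - t) + t / sqrt (\<Sum>j\<le>p. (f x j)\<^sup>2)"
      \<comment> \<open>At \<open>t = 0\<close> the first summand alone is positive; for
        \<open>t > 0\<close> the second is positive and the first nonnegative.\<close>
      using that(1) by (cases "t = 0") (auto intro!: add_nonneg_pos divide_pos_pos)
    with fx show ?thesis
      by (auto simp: E_def fun_eq_iff h_scale)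
  qed
  have conth: "continuous_on ({0..1} \<times> S) h"
  proof (rule continuous_on_coordinatewise_then_product)
    fix i
    have "continuous_on ({0..1} \<times> S) (\<lambda>y. f (snd y))"
      by (rule continuous_on_compose2[OF contf continuous_on_snd[OF continuous_on_id]])
        (use SE in auto)
    moreover have "continuous_on ({0..1} \<times> S) (\<lambda>y. g (snd y))"
      by (rule continuous_on_compose2[OF contg continuous_on_snd[OF continuous_on_id]])
        (use SE in auto)
    ultimately have "continuous_on ({0..1} \<times> S)
        (\<lambda>y :: real \<times> (nat \<Rightarrow> real). (1 - fst y) * f (snd y) i + fst y * g (snd y) i)"
      by (intro continuous_intros) (auto dest: continuous_on_product_then_coordinatewise)
    then show "continuous_on ({0..1} \<times> S) (\<lambda>y. h y i)"
      by (simp add: h_def case_prod_unfold)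
  qed
  have "homotopic_with (\<lambda>x. True) (nsphere p) (nsphere p) (\<lambda>x i. - x i) (g \<circ> g)"
  proof -
    have "continuous_on ({0..1} \<times> S) (g \<circ> h)"
      by (intro continuous_on_compose conth continuous_on_subset[OF contg]) (use hE in auto)
    moreover have "(g \<circ> h) (t, x) \<in> S" if "t \<in> {0..1}" "x \<in> S" for t x
      using hE[OF that] gS by simp
    moreover have "(g \<circ> h) (0, x) = (\<lambda>i. - x i)" if "x \<in> S" for x
      using SE[OF that] that ffE[of x] by (simp add: g_def h_def normalize_upto_def S_def)
    moreover have "(g \<circ> h) (1, x) = (g \<circ> g) x" for x
      by (simp add: h_def)
    ultimately show ?thesis
      unfolding nsphere_S
      by (subst homotopic_with) (auto simp: prod_topology_subtopology_eu intro!: exI[of _ "g \<circ> h"])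
  qed
  from Brouwer_degree2_homotopic[OF this]
  have "(- 1) ^ Suc p = Brouwer_degree2 p g * Brouwer_degree2 p g"
    by (simp only: Brouwer_degree2_antipodal Brouwer_degree2_compose[OF cmg cmg])
  \<comment> \<open>The right-hand side is the square of an integer, which rules out the sign
    -1.\<close>
  then have "(0 :: int) \<le> (- 1) ^ Suc p"
    by simp
  then show ?thesis
    unfolding Suc by (cases "even (Suc p)") auto
qed simp

text \<open>Pairing coordinates \<open>2k\<close> and \<open>2k + 1\<close> as real and imaginary
  parts, \<open>J\<close> is multiplication by the imaginary unit.\<close>

lemma square_root_of_antipodal_if_even:
  assumes "even n"
  obtains J where "continuous_map (Euclidean_space n) (Euclidean_space n) J"
    and "\<And>x. x \<in> topspace (Euclidean_space n) \<Longrightarrow> J (J x) = (\<lambda>i. - x i)"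
proof
  let ?J = "\<lambda>(x :: nat \<Rightarrow> real) i. if i < n then if even i then - x (Suc i) else x (i - 1) else 0"
  have coord: "continuous_map (Euclidean_space n) euclideanreal (\<lambda>x. x i)" for i
    unfolding Euclidean_space_def
    by (blast intro: continuous_map_from_subtopology continuous_map_product_projection)
  show "continuous_map (Euclidean_space n) (Euclidean_space n) ?J"
    unfolding continuous_map_componentwise_Euclidean_space
    by (auto intro!: continuous_map_minus coord)
  \<comment> \<open>Evenness of \<open>n\<close> enters here: the partner of an even index below
    \<open>n\<close> is again below \<open>n\<close>, so no pair is cut off by the default value
    0.\<close>
  have "Suc i < n" if "even i" "i < n" for i
    using that assms by (metis Suc_lessI even_Suc)
  then show "?J (?J x) = (\<lambda>i. - x i)" if "x \<in> topspace (Euclidean_space n)" for x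
    using that by (auto simp: topspace_Euclidean_space fun_eq_iff)
qed

section \<open>Transport to a finite-dimensional space\<close>

text \<open>Bijectivity is automatic from the functional equation, so only that equation has to be
  transported between spaces.\<close>

lemma inverse_ambiguous_iff: "inverse_ambiguous f \<longleftrightarrow> (\<forall>x. f (f x) = - x)"
proof
  assume "inverse_ambiguous f"
  then have bij: "bij f" and inv_f: "inv_into UNIV f x = - f x" for x
    by (auto simp: inverse_ambiguous_def)
  show "\<forall>x. f (f x) = - x"
  proof
    fix x
    show "f (f x) = - x"
      using inv_f[of "f x"] inv_f_f[OF bij_is_inj[OF bij], of x] by (metis minus_minus)
  qed
next
  assume ff: "\<forall>x. f (f x) = - x"
  \<comment> \<open>Four applications of \<open>f\<close> are the identity and three give
    \<open>- f x\<close>, so \<open>- f x\<close> is a preimage of \<open>x\<close>.\<close>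
  have right: "f (- f x) = x" for x
    using ff[rule_format, of "f (f x)"] ff[rule_format, of x] ff[rule_format, of "f x"] by simp
  have "inj f"
  proof (rule injI)
    fix x y assume "f x = f y"
    then have "- x = - y"
      using ff by metis
    then show "x = y"
      by simp
  qed
  moreover have "surj f"
    by (rule surjI[of f "\<lambda>x. - f x"]) (rule right)
  ultimately have "bij f"
    by (rule bijI)
  moreover have "inv_into UNIV f x = - f x" for x
    using inv_f_f[OF \<open>inj f\<close>, of "- f x"] right by simp
  ultimately show "inverse_ambiguous f"
    by (simp add: inverse_ambiguous_def)
qed

theorem theorem4p3:
  fixes T :: "'v::real_vector topology" and n :: nat
  assumes finite_dimensional: "\<exists>B. finite B \<and> span B = (UNIV :: 'v set)"
    and dimension: "dim (UNIV :: 'v set) = n"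
    and usual: "usual_topology T"
  shows "(\<exists>f :: 'v \<Rightarrow> 'v. inverse_ambiguous f \<and> continuous_map T T f) \<longleftrightarrow> even n"
proof -
  obtain m and b :: "nat \<Rightarrow> 'v" where inj: "inj_on b {..<m}"
    and ind: "independent (b ` {..<m})" and span: "span (b ` {..<m}) = UNIV"
    and hom: "homeomorphic_map (Euclidean_space m) T (\<lambda>x. \<Sum>i<m. x i *\<^sub>R b i)"
    using usual unfolding usual_topology_def by blast
  \<comment> \<open>The basis that defines the topology comes with its own length \<open>m\<close>,
    which must be matched with the given dimension.\<close>
  have "dim (UNIV :: 'v set) = card (b ` {..<m})"
    using dim_span_eq_card_independent[OF ind] span by simp
  then have m: "m = n"
    using dimension inj by (simp add: card_image)
  define \<phi> where "\<phi> = (\<lambda>x. \<Sum>i<n. x i *\<^sub>R b i)"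
  obtain \<psi> where \<phi>\<psi>: "homeomorphic_maps (Euclidean_space n) T \<phi> \<psi>"
    using hom unfolding m \<phi>_def homeomorphic_map_maps by blast
  then have \<phi>: "continuous_map (Euclidean_space n) T \<phi>"
    and \<psi>: "continuous_map T (Euclidean_space n) \<psi>"
    and \<psi>\<phi>_id: "\<And>x. x \<in> topspace (Euclidean_space n) \<Longrightarrow> \<psi> (\<phi> x) = x"
    by (auto simp: homeomorphic_maps_def)
  \<comment> \<open>Because \<open>\<phi>\<close> commutes with negation, conjugating by it
    exchanges square roots of negation on the two spaces.\<close>
  have \<phi>_minus: "\<phi> (\<lambda>i. - x i) = - \<phi> x" for x
    by (simp add: \<phi>_def sum_negf)
  \<comment> \<open>The carrier of \<open>T\<close> is so far only the image of
    \<open>\<phi>\<close>; since the basis spans, it is the whole type, and \<open>\<psi>\<close>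
    inverts \<open>\<phi>\<close> at every vector.\<close>
  have "v \<in> topspace T" for v
  proof -
    have "v \<in> range (\<lambda>u. \<Sum>w\<in>b ` {..<n}. u w *\<^sub>R w)"
      using span span_finite[of "b ` {..<n}"] m by auto
    then obtain u where "v = (\<Sum>w\<in>b ` {..<n}. u w *\<^sub>R w)"
      by auto
    also have "\<dots> = \<phi> (\<lambda>i. if i < n then u (b i) else 0)"
      using inj by (simp add: sum.reindex m \<phi>_def)
    finally show ?thesis
      using continuous_map_image_subset_topspace[OF \<phi>]
      by (auto simp: topspace_Euclidean_space)
  qed
  then have T: "topspace T = UNIV"
    by auto
  then have \<phi>\<psi>_id: "\<phi> (\<psi> v) = v" for v
    using \<phi>\<psi> by (auto simp: homeomorphic_maps_def)
  have \<psi>_mem: "\<psi> v \<in> topspace (Euclidean_space n)" for v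
    using \<psi> T by (auto simp: continuous_map_def)
  show ?thesis
  proof
    assume "\<exists>f :: 'v \<Rightarrow> 'v. inverse_ambiguous f \<and> continuous_map T T f"
    then obtain f where ff: "\<And>v. f (f v) = - v" and f: "continuous_map T T f"
      by (auto simp: inverse_ambiguous_iff)
    show "even n"
    proof (rule even_if_square_root_of_antipodal)
      show "continuous_map (Euclidean_space n) (Euclidean_space n) (\<psi> \<circ> f \<circ> \<phi>)"
        using \<phi> f \<psi> by (meson continuous_map_compose)
      fix x assume x: "x \<in> topspace (Euclidean_space n)"
      \<comment> \<open>The composite simplifies to \<open>\<psi>\<close> of \<open>\<phi>\<close>
        at the negated point, and this cancellation is available only inside the Euclidean
        space.\<close>
      then have "(\<lambda>i. - x i) \<in> topspace (Euclidean_space n)"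
        by (simp add: topspace_Euclidean_space)
      then show "(\<psi> \<circ> f \<circ> \<phi>) ((\<psi> \<circ> f \<circ> \<phi>) x) = (\<lambda>i. - x i)"
        by (simp add: \<phi>\<psi>_id ff flip: \<phi>_minus) (simp add: \<psi>\<phi>_id)
    qed
  next
    assume "even n"
    then obtain J where J: "continuous_map (Euclidean_space n) (Euclidean_space n) J"
      and JJ: "\<And>x. x \<in> topspace (Euclidean_space n) \<Longrightarrow> J (J x) = (\<lambda>i. - x i)"
      using square_root_of_antipodal_if_even by blast
    have "J (\<psi> v) \<in> topspace (Euclidean_space n)" for v
      using J \<psi>_mem by (auto simp: continuous_map_def)
    then have "inverse_ambiguous (\<phi> \<circ> J \<circ> \<psi>)"
      by (simp add: inverse_ambiguous_iff \<psi>\<phi>_id JJ \<psi>_mem \<phi>_minus \<phi>\<psi>_id)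
    moreover have "continuous_map T T (\<phi> \<circ> J \<circ> \<psi>)"
      using \<phi> J \<psi> by (meson continuous_map_compose)
    ultimately show "\<exists>f :: 'v \<Rightarrow> 'v. inverse_ambiguous f \<and> continuous_map T T f"
      by blast
  qed
qed

end
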